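(* Let $M\in\mathbb{R}^{n\times n}$, $r\in\mathbb{R}^n$. Suppose that the linear programming subproblem $\mathrm{LD}(c^k)$ at every iteration of PD-ReCR is solved exactly, with $\epsilon=0$. If the sequence $\{c^k\}$ generated by PD-ReCR is unbounded, then every accumulation point $(\bar c,\bar u,\bar v)$ of the scaled sequence $(\bar c^k,u^k,\bar v^k)$, where $\bar c^k=c^k/\|c^k\|$ and $\bar v^k=v^k/\|c^k\|$, is a global optimal solution of the problem $$\max\ r^T\bar v-\bar c^Tu\quad\text{s.t.}\quad Mu-s\ge r,\ \ M^T\bar v\le\bar c,\ \ u,\bar v,s\ge 0,$$ where the optimal objective function value equals $0$.
   Context: For fixed $c\in\mathbb{R}^n$, $\mathrm{LD}(c)$ is the linear program in $(u,v,s)$ $$\max\ r^Tv-c^Tu\quad\text{s.t.}\quad Mu-s\ge r,\ M^Tv-s\le c,\ u,v,s\ge 0,$$ which is the dual of $\mathrm{LO}(c)$: $\min\{c^Tx-r^Ty : Mx\ge r,\ M^Ty\le c,\ x\le y,\ x,y\ge 0\}$. Algorithm PD-ReCR (tolerance $\epsilon$): set $c^0=\mathbf{1}$ (all-ones vector) and let $x^0$ solve $\min\{(c^0)^Tx: Mx\ge r,\ x\ge 0\}$ (if this is infeasible, the LCP "find $x\ge0$ with $Mx\ge r$, $x^T(Mx-r)=0$" is declared infeasible). Set $c^1=M^Tx^0$ and let $(u^1,v^1,s^1)$ be an optimal solution of $\mathrm{LD}(c^1)$. For $k\ge 1$ set $c^{k+1}=c^k+s^k$ and let $(u^{k+1},v^{k+1},s^{k+1})$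 be an optimal solution of $\mathrm{LD}(c^{k+1})$; continue as long as $\|u^{k+1}-u^k\|\ge\epsilon$ (so with $\epsilon=0$ an infinite sequence is generated). The optimal solutions of $\mathrm{LD}(c)$ are taken from a strictly complementary primal--dual optimal pair with $s=\max(M^Tv-c,0)$ component-wise. In the limiting linear program in the claim, $\bar c$ is the accumulation point's first component (data), and $u,\bar v,s$ are the decision variables; $s$ does not enter the objective. *)

theory Defs
  imports "HOL-Analysis.Analysis"
begin

text \<open>Inequalities between vectors are componentwise: this is the order of the
  library on \<open>real ^ 'n\<close>.\<close>

definition LO_feasible ::
  "real^'n^'n \<Rightarrow> real^'n \<Rightarrow> real^'n \<Rightarrow> (real^'n) \<times> (real^'n) \<Rightarrow> bool" where
  "LO_feasible M r c = (\<lambda>(x, y).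
     M *v x \<ge> r \<and> transpose M *v y \<le> c \<and> x \<le> y \<and> x \<ge> 0 \<and> y \<ge> 0)"

definition LO_optimal ::
  "real^'n^'n \<Rightarrow> real^'n \<Rightarrow> real^'n \<Rightarrow> (real^'n) \<times> (real^'n) \<Rightarrow> bool" where
  "LO_optimal M r c = is_arg_min (\<lambda>(x, y). c \<bullet> x - r \<bullet> y) (LO_feasible M r c)"

definition LD_feasible ::
  "real^'n^'n \<Rightarrow> real^'n \<Rightarrow> real^'n \<Rightarrow> (real^'n) \<times> (real^'n) \<times> (real^'n) \<Rightarrow> bool" where
  "LD_feasible M r c = (\<lambda>(u, v, s).
     M *v u - s \<ge> r \<and> transpose M *v v - s \<le> c \<and> u \<ge> 0 \<and> v \<ge> 0 \<and> s \<ge> 0)"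

definition LD_optimal ::
  "real^'n^'n \<Rightarrow> real^'n \<Rightarrow> real^'n \<Rightarrow> (real^'n) \<times> (real^'n) \<times> (real^'n) \<Rightarrow> bool" where
  "LD_optimal M r c = is_arg_max (\<lambda>(u, v, s). r \<bullet> v - c \<bullet> u) (LD_feasible M r c)"

definition strict_compl_vec :: "real^'n \<Rightarrow> real^'n \<Rightarrow> bool" where
  "strict_compl_vec a b \<longleftrightarrow> (\<forall>i. a $ i * b $ i = 0 \<and> a $ i + b $ i > 0)"

text \<open>Each constraint of \<open>LO(c)\<close> (of \<open>LD(c)\<close>) is paired with its multiplier in
  \<open>LD(c)\<close> (in \<open>LO(c)\<close>).\<close>

definition strictly_complementary_pair ::
  "real^'n^'n \<Rightarrow> real^'n \<Rightarrow> real^'n \<Rightarrow> (real^'n) \<times> (real^'n)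
     \<Rightarrow> (real^'n) \<times> (real^'n) \<times> (real^'n) \<Rightarrow> bool" where
  "strictly_complementary_pair M r c = (\<lambda>(x, y) (u, v, s).
     LO_optimal M r c (x, y) \<and> LD_optimal M r c (u, v, s) \<and>
     strict_compl_vec v (M *v x - r) \<and>
     strict_compl_vec u (c - transpose M *v y) \<and>
     strict_compl_vec s (y - x) \<and>
     strict_compl_vec x (c - (transpose M *v v - s)) \<and>
     strict_compl_vec y ((M *v u - s) - r))"

text \<open>The solution of \<open>LD(c)\<close> selected by the algorithm: \<open>u\<close> and \<open>v\<close> come from a
  strictly complementary optimal pair, and \<open>s\<close> is the componentwise positive part of
  \<open>M\<^sup>T v - c\<close>. The slack \<open>s'\<close> of the pair may differ from \<open>s\<close>: demanding \<open>s' = s\<close> can be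
  impossible, e.g. for \<open>n = 1\<close>, \<open>M = 1\<close>, \<open>r = c = 0\<close>, where strict complementarity forces
  \<open>s' > v\<close>.\<close>

definition LD_selected ::
  "real^'n^'n \<Rightarrow> real^'n \<Rightarrow> real^'n \<Rightarrow> real^'n \<Rightarrow> real^'n \<Rightarrow> real^'n \<Rightarrow> bool" where
  "LD_selected M r c u v s \<longleftrightarrow>
     LD_optimal M r c (u, v, s) \<and>
     s = (\<chi> i. max ((transpose M *v v - c) $ i) 0) \<and>
     (\<exists>x y s'. strictly_complementary_pair M r c (x, y) (u, v, s'))"

text \<open>A run of the algorithm with tolerance \<open>\<epsilon>\<close> that never stops. The entries
  \<open>u 0\<close>, \<open>v 0\<close>, \<open>s 0\<close> are not produced by the algorithm and are unconstrained.\<close>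

definition PD_ReCR_run ::
  "real^'n^'n \<Rightarrow> real^'n \<Rightarrow> real \<Rightarrow> real^'n \<Rightarrow> (nat \<Rightarrow> real^'n) \<Rightarrow>
     (nat \<Rightarrow> real^'n) \<Rightarrow> (nat \<Rightarrow> real^'n) \<Rightarrow> (nat \<Rightarrow> real^'n) \<Rightarrow> bool" where
  "PD_ReCR_run M r \<epsilon> x0 c u v s \<longleftrightarrow>
     c 0 = (\<chi> i. 1) \<and>
     is_arg_min (\<lambda>x. c 0 \<bullet> x) (\<lambda>x. M *v x \<ge> r \<and> x \<ge> 0) x0 \<and>
     c 1 = transpose M *v x0 \<and>
     (\<forall>k\<ge>1. LD_selected M r (c k) (u k) (v k) (s k)) \<and>
     (\<forall>k\<ge>1. c (k + 1) = c k + s k) \<and>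
     (\<forall>k\<ge>1. norm (u (k + 1) - u k) \<ge> \<epsilon>)"

definition accumulation_point :: "(nat \<Rightarrow> 'a::topological_space) \<Rightarrow> 'a \<Rightarrow> bool" where
  "accumulation_point X l \<longleftrightarrow> (\<exists>\<phi>. strict_mono \<phi> \<and> (X \<circ> \<phi>) \<longlonglongrightarrow> l)"

text \<open>The limiting problem differs from \<open>LD(c)\<close> in that \<open>s\<close> no longer relaxes the
  constraint on \<open>v\<close>.\<close>

definition limit_feasible ::
  "real^'n^'n \<Rightarrow> real^'n \<Rightarrow> real^'n \<Rightarrow> (real^'n) \<times> (real^'n) \<times> (real^'n) \<Rightarrow> bool" where
  "limit_feasible M r c = (\<lambda>(u, v, s).
     M *v u - s \<ge> r \<and> transpose M *v v \<le> c \<and> u \<ge> 0 \<and> v \<ge> 0 \<and> s \<ge> 0)"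

definition limit_optimal ::
  "real^'n^'n \<Rightarrow> real^'n \<Rightarrow> real^'n \<Rightarrow> (real^'n) \<times> (real^'n) \<times> (real^'n) \<Rightarrow> bool" where
  "limit_optimal M r c = is_arg_max (\<lambda>(u, v, s). r \<bullet> v - c \<bullet> u) (limit_feasible M r c)"

end

theory Submission
  imports Defs
begin

text \<open>The limiting problem decouples into the linear program of minimising
  \<open>cbar \<bullet> u\<close> over \<open>M u \<ge> r\<close>, \<open>u \<ge> 0\<close> and its dual in \<open>v\<close>, so weak duality bounds its
  objective by \<open>0\<close>. It therefore suffices that the accumulation point is feasible and
  has objective at least \<open>0\<close>; it is then optimal with \<open>sbar = 0\<close>.

  The lower bound holds already along the sequence, without any scaling. The objective
  of \<open>LO(c)\<close> is nonnegative on its feasible set, again by weak duality, and a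
  complementary pair closes the gap between \<open>LO(c)\<close> and \<open>LD(c)\<close>; hence
  \<open>r \<bullet> v\<^sup>k - c\<^sup>k \<bullet> u\<^sup>k \<ge> 0\<close> for every \<open>k \<ge> 1\<close>
  (\<open>LD_selected_value_nonneg\<close>).

  For feasibility only \<open>M\<^sup>T v \<le> cbar\<close> needs an argument, since the iterates satisfy this
  constraint only up to \<open>s\<^sup>k\<close>. But \<open>s\<^sup>k \<le> M u\<^sup>k - r\<close> stays bounded where \<open>u\<^sup>k\<close> converges,
  whereas \<open>c\<^sup>k\<close> is componentwise nondecreasing and unbounded, so that its norm tends to
  infinity (\<open>filterlim_norm_incseq_unbounded\<close>) and the scaled violation vanishes.\<close>

section \<open>Weak duality and complementarity\<close>

lemma inner_mono_vec_left:
  fixes a b x :: "real^'n"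
  assumes "a \<le> b" "0 \<le> x"
  shows "a \<bullet> x \<le> b \<bullet> x"
  using assms by (auto simp: inner_vec_def less_eq_vec_def intro!: sum_mono mult_right_mono)

lemma weak_duality:
  fixes M :: "real^'n^'m"
  assumes "r \<le> M *v x" "transpose M *v y \<le> c" "0 \<le> x" "0 \<le> y"
  shows "r \<bullet> y \<le> c \<bullet> x"
proof -
  have "r \<bullet> y \<le> (M *v x) \<bullet> y"
    using assms(1,4) by (rule inner_mono_vec_left)
  also have "\<dots> = (transpose M *v y) \<bullet> x"
    by (metis dot_lmul_matrix inner_commute transpose_matrix_vector)
  also have "\<dots> \<le> c \<bullet> x"
    using assms(2,3) by (rule inner_mono_vec_left)
  finally show ?thesis .
qed

lemma strict_compl_vec_imp_inner_eq_0:
  "strict_compl_vec a b \<Longrightarrow> a \<bullet> b = 0"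
  unfolding strict_compl_vec_def inner_vec_def by (intro sum.neutral) simp

text \<open>Adding up the five complementarity relations cancels every term in which two
  variables meet, and leaves the two objectives.\<close>

lemma strictly_complementary_pair_values_eq:
  assumes "strictly_complementary_pair M r c (x, y) (u, v, s)"
  shows "c \<bullet> x - r \<bullet> y = r \<bullet> v - c \<bullet> u"
proof -
  have "v \<bullet> (M *v x - r) = 0" "u \<bullet> (c - transpose M *v y) = 0" "s \<bullet> (y - x) = 0"
    "x \<bullet> (c - (transpose M *v v - s)) = 0" "y \<bullet> ((M *v u - s) - r) = 0"
    using assms unfolding strictly_complementary_pair_def
    by (auto intro: strict_compl_vec_imp_inner_eq_0)
  moreover have "x \<bullet> (transpose M *v v) = v \<bullet> (M *v x)" "u \<bullet> (transpose M *v y) = y \<bullet> (M *v u)"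
    by (metis dot_lmul_matrix inner_commute transpose_matrix_vector)+
  ultimately show ?thesis
    by (simp add: inner_diff_right inner_commute algebra_simps)
qed

lemma LD_selected_imp_feasible:
  "LD_selected M r c u v s \<Longrightarrow> LD_feasible M r c (u, v, s)"
  unfolding LD_selected_def LD_optimal_def is_arg_max_def by blast

lemma LD_selected_value_nonneg:
  assumes "LD_selected M r c u v s"
  shows "0 \<le> r \<bullet> v - c \<bullet> u"
proof -
  obtain x y s' where pair: "strictly_complementary_pair M r c (x, y) (u, v, s')"
    using assms unfolding LD_selected_def by blast
  then have "LO_feasible M r c (x, y)"
    by (simp add: strictly_complementary_pair_def LO_optimal_def is_arg_min_def)
  then have "r \<bullet> y \<le> c \<bullet> x"
    by (auto simp: LO_feasible_def intro: weak_duality)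
  then show ?thesis
    using strictly_complementary_pair_values_eq[OF pair] by simp
qed

section \<open>The limiting problem\<close>

lemma limit_optimalI_value_nonneg:
  assumes feas: "limit_feasible M r c (u, v, s)" and "0 \<le> r \<bullet> v - c \<bullet> u"
  shows "limit_optimal M r c (u, v, s)" "r \<bullet> v - c \<bullet> u = 0"
proof -
  have le: "r \<bullet> v' - c \<bullet> u' \<le> 0" if "limit_feasible M r c (u', v', s')" for u' v' s'
  proof -
    have "r + s' \<le> M *v u'" "0 \<le> s'"
      using that by (auto simp: limit_feasible_def le_diff_eq)
    then have "r \<le> M *v u'"
      using add_increasing2 order_trans by blast
    then show ?thesis
      using that weak_duality[of r M u' v' c] by (simp add: limit_feasible_def)
  qed
  show "r \<bullet> v - c \<bullet> u = 0"
    using le[OF feas] assms(2) by simp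
  then show "limit_optimal M r c (u, v, s)"
    using feas le by (fastforce simp: limit_optimal_def is_arg_max_def)
qed

section \<open>Growth of the cost vectors\<close>

text \<open>The norm itself need not be monotone, because components may start negative; the
  norm of the increment over the first term is.\<close>

lemma filterlim_norm_incseq_unbounded:
  fixes X :: "nat \<Rightarrow> real^'n"
  assumes "incseq X" "\<not> bounded (range X)"
  shows "filterlim (\<lambda>k. norm (X k)) at_top sequentially"
  unfolding filterlim_at_top
proof
  fix B :: real
  obtain m where m: "norm (X m) > B + 2 * norm (X 0)"
    using assms(2) by (force simp: bounded_iff not_le)
  have "B \<le> norm (X k)" if "m \<le> k" for k
  proof -
    have "X 0 \<le> X m" "X m \<le> X k"
      using assms(1) that by (auto simp: incseq_def)
    then have "norm (X m - X 0) \<le> norm (X k - X 0)"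
      unfolding less_eq_vec_def
      by (intro norm_le_componentwise_cart) (smt (verit) real_norm_def vector_minus_component)
    then show ?thesis
      using m norm_triangle_ineq2[of "X m" "X 0"] norm_triangle_ineq4[of "X k" "X 0"]
      by linarith
  qed
  then show "\<forall>\<^sub>F k in sequentially. B \<le> norm (X k)"
    by (auto simp: eventually_sequentially)
qed

lemma PD_ReCR_run_norm_at_top:
  assumes run: "PD_ReCR_run M r \<epsilon> x0 c u v s" and unb: "\<not> bounded (range c)"
  shows "filterlim (\<lambda>k. norm (c k)) at_top sequentially"
proof -
  have "c (Suc k) \<le> c (Suc (Suc k))" for k
  proof -
    have "LD_selected M r (c (Suc k)) (u (Suc k)) (v (Suc k)) (s (Suc k))"
      using run by (simp add: PD_ReCR_run_def)
    then have "0 \<le> s (Suc k)"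
      by (auto simp: LD_feasible_def dest: LD_selected_imp_feasible)
    moreover have "c (Suc (Suc k)) = c (Suc k) + s (Suc k)"
      using run by (simp add: PD_ReCR_run_def)
    ultimately show ?thesis
      by simp
  qed
  then have "incseq (\<lambda>k. c (Suc k))"
    by (rule incseq_SucI)
  moreover have "range c = insert (c 0) (range (\<lambda>k. c (Suc k)))"
    by (metis UNIV_nat_eq image_image image_insert)
  then have "\<not> bounded (range (\<lambda>k. c (Suc k)))"
    using unb by simp
  ultimately have "filterlim (\<lambda>k. norm (c (Suc k))) at_top sequentially"
    by (rule filterlim_norm_incseq_unbounded)
  then show ?thesis
    by (rule filterlim_sequentially_Suc[THEN iffD1])
qed

section \<open>Passage to the limit\<close>

lemma LIMSEQ_le_vec:
  fixes X Y :: "nat \<Rightarrow> real^'n"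
  assumes "X \<longlonglongrightarrow> a" "Y \<longlonglongrightarrow> b" "\<forall>\<^sub>F k in sequentially. X k \<le> Y k"
  shows "a \<le> b"
  unfolding less_eq_vec_def
proof
  fix i
  show "a $ i \<le> b $ i"
  proof (rule tendsto_le[OF sequentially_bot])
    show "(\<lambda>k. Y k $ i) \<longlonglongrightarrow> b $ i" "(\<lambda>k. X k $ i) \<longlonglongrightarrow> a $ i"
      using assms(1,2) by (auto intro: tendsto_vec_nth)
    show "\<forall>\<^sub>F k in sequentially. X k $ i \<le> Y k $ i"
      using assms(3) by eventually_elim (simp add: less_eq_vec_def)
  qed
qed

text \<open>Eliminating \<open>s\<close> from the two constraints of \<open>LD(c)\<close> gives the bound on
  \<open>M\<^sup>T v\<close> whose excess over \<open>c\<close> does not depend on \<open>c\<close> and is controlled by \<open>u\<close> alone.\<close>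

lemma LD_feasible_bounds:
  assumes "LD_feasible M r c (u, v, s)"
  shows "r \<le> M *v u" "transpose M *v v \<le> c + (M *v u - r)"
proof -
  have s: "0 \<le> s" "s \<le> M *v u - r" "transpose M *v v \<le> c + s"
    using assms by (auto simp: LD_feasible_def algebra_simps)
  from order_trans[OF s(1,2)] show "r \<le> M *v u"
    by simp
  show "transpose M *v v \<le> c + (M *v u - r)"
    using s(3) add_left_mono[OF s(2)] by (rule order_trans)
qed

theorem theorem3p4:
  fixes M :: "real^'n^'n" and r x0 :: "real^'n"
    and c u v s :: "nat \<Rightarrow> real^'n"
    and cbar ubar vbar :: "real^'n"
  assumes "PD_ReCR_run M r 0 x0 c u v s"
    and "\<not> bounded (range c)"
    and "accumulation_point
           (\<lambda>k. (c k /\<^sub>R norm (c k), u k, v k /\<^sub>R norm (c k))) (cbar, ubar, vbar)"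
  shows "(\<exists>sbar. limit_optimal M r cbar (ubar, vbar, sbar)) \<and>
         r \<bullet> vbar - cbar \<bullet> ubar = 0"
proof -
  obtain \<phi> where \<phi>: "strict_mono \<phi>"
    and lim: "(\<lambda>k. (c (\<phi> k) /\<^sub>R norm (c (\<phi> k)), u (\<phi> k), v (\<phi> k) /\<^sub>R norm (c (\<phi> k))))
                \<longlonglongrightarrow> (cbar, ubar, vbar)"
    using assms(3) by (auto simp: accumulation_point_def o_def)
  define t where "t k = inverse (norm (c (\<phi> k)))" for k
  have cl: "(\<lambda>k. t k *\<^sub>R c (\<phi> k)) \<longlonglongrightarrow> cbar"
    and ul: "(\<lambda>k. u (\<phi> k)) \<longlonglongrightarrow> ubar"
    and vl: "(\<lambda>k. t k *\<^sub>R v (\<phi> k)) \<longlonglongrightarrow> vbar"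
    using tendsto_fst[OF lim] tendsto_fst[OF tendsto_snd[OF lim]]
      tendsto_snd[OF tendsto_snd[OF lim]] by (simp_all add: t_def)
  have t_nonneg: "0 \<le> t k" for k
    by (simp add: t_def)
  have tl: "t \<longlonglongrightarrow> 0"
    unfolding t_def using PD_ReCR_run_norm_at_top[OF assms(1,2)] filterlim_subseq[OF \<phi>]
    by (intro tendsto_inverse_0_at_top) (rule filterlim_compose)
  have Mu: "(\<lambda>k. M *v u (\<phi> k)) \<longlonglongrightarrow> M *v ubar"
    using ul by (intro bounded_linear.tendsto[OF matrix_vector_mul_bounded_linear])
  have Mv: "(\<lambda>k. transpose M *v (t k *\<^sub>R v (\<phi> k))) \<longlonglongrightarrow> transpose M *v vbar"
    using vl by (intro bounded_linear.tendsto[OF matrix_vector_mul_bounded_linear])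
  (* Only the entries from index 1 on belong to the run. *)
  have sel: "\<forall>\<^sub>F k in sequentially.
      LD_selected M r (c (\<phi> k)) (u (\<phi> k)) (v (\<phi> k)) (s (\<phi> k))"
  proof (rule eventually_sequentiallyI[of 1])
    fix k :: nat
    assume "1 \<le> k"
    then have "1 \<le> \<phi> k"
      using seq_suble[OF \<phi>, of k] by linarith
    then show "LD_selected M r (c (\<phi> k)) (u (\<phi> k)) (v (\<phi> k)) (s (\<phi> k))"
      using assms(1) by (simp add: PD_ReCR_run_def)
  qed
  then have feas: "\<forall>\<^sub>F k in sequentially.
      LD_feasible M r (c (\<phi> k)) (u (\<phi> k), v (\<phi> k), s (\<phi> k))"
    by eventually_elim (rule LD_selected_imp_feasible)

  have "r \<le> M *v ubar"
    using feas by (intro LIMSEQ_le_vec[OF tendsto_const Mu])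
      (auto elim!: eventually_mono intro: LD_feasible_bounds)
  moreover have "0 \<le> ubar"
    using feas by (intro LIMSEQ_le_vec[OF tendsto_const ul])
      (auto elim!: eventually_mono simp: LD_feasible_def)
  moreover have "0 \<le> vbar"
    using feas by (intro LIMSEQ_le_vec[OF tendsto_const vl])
      (auto elim!: eventually_mono simp: LD_feasible_def t_nonneg intro: scaleR_nonneg_nonneg)
  moreover have "transpose M *v vbar \<le> cbar"
  proof (rule LIMSEQ_le_vec[OF Mv])
    show "(\<lambda>k. t k *\<^sub>R c (\<phi> k) + t k *\<^sub>R (M *v u (\<phi> k) - r)) \<longlonglongrightarrow> cbar"
      using tendsto_add[OF cl tendsto_scaleR[OF tl tendsto_diff[OF Mu tendsto_const]]] by simp
    show "\<forall>\<^sub>F k in sequentially. transpose M *v (t k *\<^sub>R v (\<phi> k))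
        \<le> t k *\<^sub>R c (\<phi> k) + t k *\<^sub>R (M *v u (\<phi> k) - r)"
      using feas
    proof eventually_elim
      case (elim k)
      then show ?case
        using scaleR_left_mono[OF LD_feasible_bounds(2) t_nonneg]
        by (simp add: matrix_vector_mult_scaleR scaleR_add_right)
    qed
  qed
  ultimately have "limit_feasible M r cbar (ubar, vbar, 0)"
    by (simp add: limit_feasible_def)
  moreover have "0 \<le> r \<bullet> vbar - cbar \<bullet> ubar"
  proof (rule tendsto_lowerbound)
    show "(\<lambda>k. r \<bullet> (t k *\<^sub>R v (\<phi> k)) - (t k *\<^sub>R c (\<phi> k)) \<bullet> u (\<phi> k))
        \<longlonglongrightarrow> r \<bullet> vbar - cbar \<bullet> ubar"
      using cl ul vl by (intro tendsto_intros)
    show "\<forall>\<^sub>F k in sequentially.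
        0 \<le> r \<bullet> (t k *\<^sub>R v (\<phi> k)) - (t k *\<^sub>R c (\<phi> k)) \<bullet> u (\<phi> k)"
      using sel
    proof eventually_elim
      case (elim k)
      then show ?case
        using mult_nonneg_nonneg[OF t_nonneg LD_selected_value_nonneg]
        by (simp add: right_diff_distrib)
    qed
  qed simp
  ultimately show ?thesis
    using limit_optimalI_value_nonneg by blast
qed

end
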